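(* The conjugacy problem in every graph biautomatic group is decidable. That is, let $G$ be a group generated by a finite set $X$ such that the natural map $X^\star\to G$ is onto, and suppose $G$ is graph biautomatic with respect to $X$. Then there is an algorithm which, given two words $p,q\in X^\star$, decides whether the elements of $G$ represented by $p$ and $q$ are conjugate in $G$.
   Context: For a finite alphabet $\Sigma$, let $\Sigma^\star$ be the set of finite strings over $\Sigma$. For strings $w_1,\dots,w_n\in\Sigma^\star$ the convolution $\otimes(w_1,\dots,w_n)$ is the string of length $\max_i|w_i|$ over the alphabet $(\Sigma\cup\{\diamond\})^n$ (with $\diamond\notin\Sigma$) whose $k$-th symbol is $(\sigma_1,\dots,\sigma_n)$, where $\sigma_i$ is the $k$-th symbol of $w_i$ if $k\le|w_i|$ and $\sigma_i=\diamond$ otherwise. A relation $R\subseteq(\Sigma^\star)^n$ is FA recognizable if $\{\otimes(w_1,\dots,w_n)\mid (w_1,\dots,w_n)\in R\}$ is a regular language (recognized by a finite automaton). A group $G$ generated by a finite set $X$ is (Cayley) graph biautomatic with respect to $X$ if there are a finite alphabet $\Sigma$, a regular language $R\subseteq\Sigma^\star$ and a bijection $\nu:R\to G$ such that for every $x\in X$ both relations $\{(u,v)\in R^2\mid \nu(u)x=\nu(v)\}$ and $\{(u,v)\in R^2\mid x\nu(u)=\nu(v)\}$ are FA recognizable. A word $w\in X^\star$ represents the product in $G$ of its letters. *)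

theory Defs
  imports "HOL-Algebra.Group" "HOL-Library.Nat_Bijection"
begin

section \<open>Regular languages and FA recognizable relations\<close>

text \<open>
  Recognition by a deterministic finite automaton.  A finite state set can be renamed
  to a set of natural numbers, so that is the type of states used here.
\<close>

definition regular_language :: "'s set \<Rightarrow> 's list set \<Rightarrow> bool" where
  "regular_language A L \<longleftrightarrow>
     (\<exists>(Q :: nat set) q0 F \<delta>. finite Q \<and> q0 \<in> Q \<and> F \<subseteq> Q \<and>
        (\<forall>q\<in>Q. \<forall>a\<in>A. \<delta> q a \<in> Q) \<and>
        L = {w \<in> lists A. foldl \<delta> q0 w \<in> F})"

text \<open>
  A tuple of \<open>n\<close> strings is a list of length \<open>n\<close>; a convolution letter is a list
  of length \<open>n\<close> over \<^typ>\<open>'s option\<close>, with \<^term>\<open>None\<close> as the padding symbol.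
\<close>

definition convolution :: "'s list list \<Rightarrow> 's option list list" where
  "convolution ws =
     map (\<lambda>k. map (\<lambda>w. if k < length w then Some (w ! k) else None) ws)
         [0..<Max (insert 0 (length ` set ws))]"

definition conv_alphabet :: "'s set \<Rightarrow> nat \<Rightarrow> 's option list set" where
  "conv_alphabet \<Sigma> n = {t. length t = n \<and> set t \<subseteq> insert None (Some ` \<Sigma>)}"

definition fa_recognizable :: "'s set \<Rightarrow> nat \<Rightarrow> 's list list set \<Rightarrow> bool" where
  "fa_recognizable \<Sigma> n R \<longleftrightarrow>
     R \<subseteq> {ws. length ws = n \<and> set ws \<subseteq> lists \<Sigma>} \<and>
     regular_language (conv_alphabet \<Sigma> n) (convolution ` R)"

section \<open>Graph biautomatic groups\<close>

definition graph_biautomatic_structure ::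
    "('a, 'm) monoid_scheme \<Rightarrow> 'a set \<Rightarrow> 's set \<Rightarrow> 's list set \<Rightarrow> ('s list \<Rightarrow> 'a) \<Rightarrow> bool" where
  "graph_biautomatic_structure G X \<Sigma> R nu \<longleftrightarrow>
     finite \<Sigma> \<and> regular_language \<Sigma> R \<and> bij_betw nu R (carrier G) \<and>
     (\<forall>x\<in>X. fa_recognizable \<Sigma> 2 {[u, v] | u v. u \<in> R \<and> v \<in> R \<and> nu u \<otimes>\<^bsub>G\<^esub> x = nu v} \<and>
            fa_recognizable \<Sigma> 2 {[u, v] | u v. u \<in> R \<and> v \<in> R \<and> x \<otimes>\<^bsub>G\<^esub> nu u = nu v})"

text \<open>
  One cannot quantify existentially over the type of the alphabet; taking natural
  numbers as symbols loses nothing, see \<open>graph_biautomaticI\<close> below.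
\<close>

definition graph_biautomatic :: "('a, 'm) monoid_scheme \<Rightarrow> 'a set \<Rightarrow> bool" where
  "graph_biautomatic G X \<longleftrightarrow>
     (\<exists>(\<Sigma> :: nat set) R nu. graph_biautomatic_structure G X \<Sigma> R nu)"

lemma regular_language_map:
  assumes L: "regular_language A L" and f: "inj_on f A"
  shows "regular_language (f ` A) (map f ` L)"
proof -
  obtain Q :: "nat set" and q0 F \<delta> where Q: "finite Q" "q0 \<in> Q" "F \<subseteq> Q"
    "\<forall>q\<in>Q. \<forall>a\<in>A. \<delta> q a \<in> Q" and L_eq: "L = {w \<in> lists A. foldl \<delta> q0 w \<in> F}"
    using L unfolding regular_language_def by blast
  define \<delta>' where "\<delta>' = (\<lambda>q b. \<delta> q (inv_into A f b))"
  have fold: "foldl \<delta>' q (map f w) = foldl \<delta> q w" if "\<forall>a\<in>set w. a \<in> A" for q w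
    using that by (induction w arbitrary: q) (auto simp: \<delta>'_def f)
  have "map f ` L = {w \<in> lists (f ` A). foldl \<delta>' q0 w \<in> F}"
    unfolding L_eq lists_image by (auto simp: fold image_iff in_lists_conv_set)
  moreover have "\<forall>q\<in>Q. \<forall>b\<in>f ` A. \<delta>' q b \<in> Q"
    using Q(4) f by (auto simp: \<delta>'_def)
  ultimately show ?thesis
    using Q(1-3) unfolding regular_language_def by blast
qed

lemma convolution_map:
  "convolution (map (map f) ws) = map (map (map_option f)) (convolution ws)"
  by (auto simp: convolution_def image_image)

lemma conv_alphabet_image:
  "conv_alphabet (f ` \<Sigma>) n = map (map_option f) ` conv_alphabet \<Sigma> n"
proof -
  have *: "conv_alphabet S n = {t \<in> lists (insert None (Some ` S)). length t = n}" for S :: "'c set"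
    by (auto simp: conv_alphabet_def)
  have **: "insert None (Some ` (f ` \<Sigma>)) = map_option f ` insert None (Some ` \<Sigma>)"
    by (auto simp: image_image)
  show ?thesis
    unfolding * ** lists_image by auto
qed

lemma fa_recognizable_map:
  assumes R: "fa_recognizable \<Sigma> n R" and f: "inj_on f \<Sigma>"
  shows "fa_recognizable (f ` \<Sigma>) n (map (map f) ` R)"
proof -
  have inj: "inj_on (map (map_option f)) (conv_alphabet \<Sigma> n)"
  proof -
    have "inj_on (map_option f) (insert None (Some ` \<Sigma>))"
      using f by (auto simp: inj_on_def)
    then have "inj_on (map (map_option f)) (lists (insert None (Some ` \<Sigma>)))"
      by (rule inj_on_map_lists)
    then show ?thesis
      by (rule inj_on_subset) (auto simp: conv_alphabet_def)
  qed
  have "regular_language (map (map_option f) ` conv_alphabet \<Sigma> n)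
          (map (map (map_option f)) ` convolution ` R)"
    using R inj by (intro regular_language_map) (auto simp: fa_recognizable_def)
  then show ?thesis
    using R by (fastforce simp: fa_recognizable_def conv_alphabet_image convolution_map image_image)
qed

lemma graph_biautomaticI:
  assumes "graph_biautomatic_structure G X \<Sigma> R nu"
  shows "graph_biautomatic G X"
proof -
  note S = assms[unfolded graph_biautomatic_structure_def]
  obtain f :: "'c \<Rightarrow> nat" where f: "inj_on f \<Sigma>"
    using S finite_imp_inj_to_nat_seg by metis
  have "R \<subseteq> lists \<Sigma>"
    using S by (auto simp: regular_language_def)
  define nu' where "nu' = nu \<circ> map (inv_into \<Sigma> f)"
  have nu': "nu' (map f u) = nu u" if "u \<in> R" for u
  proof -
    have "map (inv_into \<Sigma> f) (map f u) = u"
      using that \<open>R \<subseteq> lists \<Sigma>\<close> f by (auto intro!: map_idI)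
    then show ?thesis by (simp add: nu'_def)
  qed
  have injR: "inj_on (map f) R"
    using inj_on_map_lists[OF f] \<open>R \<subseteq> lists \<Sigma>\<close> by (rule inj_on_subset)
  have bij: "bij_betw nu' (map f ` R) (carrier G)"
  proof -
    have "bij_betw (nu' \<circ> map f) R (carrier G) \<longleftrightarrow> bij_betw nu R (carrier G)"
      by (rule bij_betw_cong) (simp add: nu')
    then show ?thesis
      using S injR by (simp add: bij_betw_def inj_on_imageI image_comp)
  qed
  have rel: "{[u, v] | u v. u \<in> map f ` R \<and> v \<in> map f ` R \<and> P (nu' u) (nu' v)} =
      map (map f) ` {[u, v] | u v. u \<in> R \<and> v \<in> R \<and> P (nu u) (nu v)}" for P
    by (auto simp: nu' image_iff) (metis nu' list.simps(8,9))+
  have "graph_biautomatic_structure G X (f ` \<Sigma>) (map f ` R) nu'"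
    unfolding graph_biautomatic_structure_def
    using S f bij
    by (auto intro!: regular_language_map fa_recognizable_map
        simp: rel[of "\<lambda>a b. a \<otimes>\<^bsub>G\<^esub> _ = b"] rel[of "\<lambda>a b. _ \<otimes>\<^bsub>G\<^esub> a = b"])
  then show ?thesis
    unfolding graph_biautomatic_def by blast
qed

section \<open>Computability\<close>

text \<open>
  Partial recursive functions (Kleene).  Arities are not recorded: a term is applied
  to an argument list of any length, and a term that needs an argument that is not there is
  undefined.  \<open>Mu f\<close> is undefined unless \<open>f\<close> is defined at all smaller arguments.
\<close>

datatype recf =
  Zero | Succ | Proj nat | Comp recf "recf list" | PrimRec recf recf | Mu recf

fun recf_eval :: "recf \<Rightarrow> nat list \<Rightarrow> nat option" where
  "recf_eval Zero xs = Some 0"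
| "recf_eval Succ xs = (case xs of [] \<Rightarrow> None | x # _ \<Rightarrow> Some (Suc x))"
| "recf_eval (Proj i) xs = (if i < length xs then Some (xs ! i) else None)"
| "recf_eval (Comp f gs) xs =
     (if \<forall>g\<in>set gs. recf_eval g xs \<noteq> None
      then recf_eval f (map (\<lambda>g. the (recf_eval g xs)) gs) else None)"
| "recf_eval (PrimRec f g) xs =
     (case xs of [] \<Rightarrow> None
      | n # ys \<Rightarrow> rec_nat (recf_eval f ys)
          (\<lambda>m r. case r of None \<Rightarrow> None | Some v \<Rightarrow> recf_eval g (m # v # ys)) n)"
| "recf_eval (Mu f) xs =
     (if \<exists>n. recf_eval f (n # xs) = Some 0 \<and> (\<forall>m<n. recf_eval f (m # xs) \<noteq> None)
      then Some (LEAST n. recf_eval f (n # xs) = Some 0) else None)"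

text \<open>
  Words over \<open>X\<close> are given to an algorithm through a numbering of the letters and the
  standard coding of lists.  For finite \<open>X\<close> any two numberings differ by a finite table,
  so it is immaterial which one is used; all of them are required to work.
\<close>

definition decidable_on_words :: "'a set \<Rightarrow> ('a list \<Rightarrow> 'a list \<Rightarrow> bool) \<Rightarrow> bool" where
  "decidable_on_words X P \<longleftrightarrow>
     (\<forall>c :: 'a \<Rightarrow> nat. inj_on c X \<longrightarrow>
        (\<exists>f. \<forall>p\<in>lists X. \<forall>q\<in>lists X.
           recf_eval f [list_encode (map c p), list_encode (map c q)] =
             Some (if P p q then 1 else 0)))"

section \<open>The conjugacy problem\<close>

definition word_value :: "('a, 'm) monoid_scheme \<Rightarrow> 'a list \<Rightarrow> 'a" where
  "word_value G w = foldr (\<otimes>\<^bsub>G\<^esub>) w \<one>\<^bsub>G\<^esub>"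

definition conjugate_in :: "('a, 'm) monoid_scheme \<Rightarrow> 'a \<Rightarrow> 'a \<Rightarrow> bool" where
  "conjugate_in G a b \<longleftrightarrow> (\<exists>g\<in>carrier G. b = inv\<^bsub>G\<^esub> g \<otimes>\<^bsub>G\<^esub> a \<otimes>\<^bsub>G\<^esub> g)"

definition decidable_conjugacy_problem :: "('a, 'm) monoid_scheme \<Rightarrow> 'a set \<Rightarrow> bool" where
  "decidable_conjugacy_problem G X \<longleftrightarrow>
     decidable_on_words X (\<lambda>p q. conjugate_in G (word_value G p) (word_value G q))"

end

theory Submission
  imports Defs
begin

text \<open>
  The word \<open>p\<close> and the word \<open>q\<close> are conjugate iff some \<open>g\<close> is fixed by the composition of the right
  translations by the letters of \<open>q\<close> with the left translations by the inverses of the letters of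
  \<open>p\<close>.  On normal forms every such translation is a relation recognized by a two-tape automaton, so
  a fixed point is a closed chain of words in which neighbours satisfy automatic constraints.
  Running all the automata in parallel and cutting out a segment between two equal state vectors,
  from all words of the chain at once, gives a shorter chain.  Hence, with \<open>N\<close> bounding the numbers
  of states, a fixed point has a normal form of length at most \<open>N\<close> to the power
  \<open>1 + |p| + |q|\<close> if there is any, and a bounded search decides conjugacy.
\<close>

section \<open>Computable functions\<close>

text \<open>Only argument lists of length \<open>n\<close> matter, so terms such as
  \<open>drop 2 ys\<close> or \<open>tl ys\<close> can be rewritten into projections under a known
  length.\<close>

definition computable :: "nat \<Rightarrow> (nat list \<Rightarrow> nat) \<Rightarrow> bool" where
  "computable n f \<longleftrightarrow> (\<exists>r. \<forall>xs. length xs = n \<longrightarrow> recf_eval r xs = Some (f xs))"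

abbreviation decidable :: "nat \<Rightarrow> (nat list \<Rightarrow> bool) \<Rightarrow> bool" where
  "decidable n P \<equiv> computable n (\<lambda>xs. of_bool (P xs))"

lemma computable_cong:
  assumes "computable n f" "\<And>xs. length xs = n \<Longrightarrow> f xs = g xs"
  shows "computable n g"
  using assms unfolding computable_def by metis

lemma computable_nth: "i < n \<Longrightarrow> computable n (\<lambda>xs. xs ! i)"
  unfolding computable_def by (intro exI[of _ "Proj i"]) simp

lemma computable_compose:
  assumes f: "computable (length gs) f" and gs: "\<forall>g\<in>set gs. computable n g"
  shows "computable n (\<lambda>xs. f (map (\<lambda>g. g xs) gs))"
proof -
  obtain rf where rf: "\<And>xs. length xs = length gs \<Longrightarrow> recf_eval rf xs = Some (f xs)"
    using f unfolding computable_def by blast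
  obtain r where r: "\<forall>g\<in>set gs. \<forall>xs. length xs = n \<longrightarrow> recf_eval (r g) xs = Some (g xs)"
    using bchoice[OF gs[unfolded computable_def]] by blast
  have "recf_eval (Comp rf (map r gs)) xs = Some (f (map (\<lambda>g. g xs) gs))" if "length xs = n" for xs
  proof -
    have "map (\<lambda>g. the (recf_eval g xs)) (map r gs) = map (\<lambda>g. g xs) gs"
      using r that by simp
    then show ?thesis
      using r that rf[of "map (\<lambda>g. g xs) gs"] by (simp del: map_map)
  qed
  then show ?thesis
    unfolding computable_def by blast
qed

lemma computable_Suc:
  assumes "computable n f"
  shows "computable n (\<lambda>xs. Suc (f xs))"
proof -
  have "computable (length [f]) (\<lambda>ys. Suc (ys ! 0))"
    unfolding computable_def by (intro exI[of _ Succ]) (auto split: list.split)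
  from computable_compose[OF this] show ?thesis
    using assms by simp
qed

lemma computable_const: "computable n (\<lambda>_. k)"
proof (induction k)
  case 0
  show ?case unfolding computable_def by (intro exI[of _ Zero]) simp
qed (rule computable_Suc)

text \<open>In a primitive recursion the counter and the accumulator precede the parameters; this
  lets a function of the parameters alone be used in a step.\<close>

lemma computable_drop2:
  assumes "computable n f"
  shows "computable (Suc (Suc n)) (\<lambda>ys. f (drop 2 ys))"
proof -
  let ?gs = "map (\<lambda>i ys. ys ! (2 + i)) [0..<n] :: (nat list \<Rightarrow> nat) list"
  have "computable (Suc (Suc n)) (\<lambda>ys. f (map (\<lambda>g. g ys) ?gs))"
    using assms by (intro computable_compose) (auto intro: computable_nth)
  then show ?thesis
    by (rule computable_cong) (auto intro!: arg_cong[of _ _ f] nth_equalityI)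
qed

lemma computable_nth_drop2: "Suc (Suc i) < n \<Longrightarrow> computable n (\<lambda>ys. drop 2 ys ! i)"
  by (rule computable_cong[OF computable_nth[of "Suc (Suc i)"]]) auto

lemma computable_nth_tl: "Suc i < n \<Longrightarrow> computable n (\<lambda>ys. tl ys ! i)"
  by (rule computable_cong[OF computable_nth[of "Suc i"]]) (auto simp: nth_tl)

lemma computable_nth_tl_tl: "Suc (Suc i) < n \<Longrightarrow> computable n (\<lambda>ys. tl (tl ys) ! i)"
  by (rule computable_cong[OF computable_nth[of "Suc (Suc i)"]]) (auto simp: nth_tl)

lemma computable_rec_nat:
  assumes b: "computable n b" and k: "computable n k"
    and s: "computable (Suc (Suc n)) (\<lambda>ys. s (ys ! 0) (ys ! 1) (drop 2 ys))"
  shows "computable n (\<lambda>xs. rec_nat (b xs) (\<lambda>m r. s m r xs) (k xs))"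
proof -
  obtain rb where rb: "\<And>xs. length xs = n \<Longrightarrow> recf_eval rb xs = Some (b xs)"
    using b unfolding computable_def by blast
  obtain rs where rs: "\<And>ys. length ys = Suc (Suc n) \<Longrightarrow>
      recf_eval rs ys = Some (s (ys ! 0) (ys ! 1) (drop 2 ys))"
    using s unfolding computable_def by blast
  let ?f = "\<lambda>ys. rec_nat (b (tl ys)) (\<lambda>m r. s m r (tl ys)) (hd ys)"
  \<comment> \<open>\<open>PrimRec\<close> recurses on its first argument, so the depth
    \<open>k\<close> is put in front of the parameters.\<close>
  let ?gs = "k # map (\<lambda>i xs. xs ! i) [0..<n]"
  have "recf_eval (PrimRec rb rs) (m # xs) = Some (?f (m # xs))" if "length xs = n" for m xs
    using that by (induction m) (auto simp: rb rs)
  then have "computable (Suc n) ?f"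
    unfolding computable_def by (intro exI[of _ "PrimRec rb rs"]) (auto simp: length_Suc_conv)
  then have "computable n (\<lambda>xs. ?f (map (\<lambda>g. g xs) ?gs))"
    using k by (intro computable_compose) (auto intro: computable_nth)
  then show ?thesis
  proof (rule computable_cong)
    fix xs :: "nat list"
    assume "length xs = n"
    then have "map (\<lambda>g. g xs) ?gs = k xs # xs"
      by (auto simp: comp_def intro: nth_equalityI)
    then show "?f (map (\<lambda>g. g xs) ?gs) = rec_nat (b xs) (\<lambda>m r. s m r xs) (k xs)"
      by simp
  qed
qed

text \<open>\<open>Mu\<close> looks for a zero, hence the program decides the negation of
  \<open>P\<close>. It is total and a solution exists, so the minimization is defined.\<close>

lemma computable_Least:
  assumes P: "decidable (Suc n) (\<lambda>ys. \<not> P (ys ! 0) (tl ys))"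
    and ex: "\<And>xs. length xs = n \<Longrightarrow> \<exists>m. P m xs"
  shows "computable n (\<lambda>xs. LEAST m. P m xs)"
proof -
  obtain r where r: "\<And>ys. length ys = Suc n \<Longrightarrow> recf_eval r ys = Some (of_bool (\<not> P (ys ! 0) (tl ys)))"
    using P unfolding computable_def by blast
  have "recf_eval (Mu r) xs = Some (LEAST m. P m xs)" if "length xs = n" for xs
  proof -
    have "recf_eval r (m # xs) = Some (of_bool (\<not> P m xs))" for m
      using r[of "m # xs"] that by simp
    then show ?thesis
      using ex[OF that] by simp
  qed
  then show ?thesis
    unfolding computable_def by blast
qed

lemma computable_apply2:
  assumes "computable 2 (\<lambda>ys. h (ys ! 0) (ys ! 1))" "computable n f" "computable n g"
  shows "computable n (\<lambda>xs. h (f xs) (g xs))"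
  using computable_compose[of "[f, g]" "\<lambda>ys. h (ys ! 0) (ys ! 1)" n] assms
  by (simp add: numeral_2_eq_2)

lemma computable_apply3:
  assumes "computable 3 (\<lambda>ys. h (ys ! 0) (ys ! 1) (ys ! 2))"
    "computable n e" "computable n f" "computable n g"
  shows "computable n (\<lambda>xs. h (e xs) (f xs) (g xs))"
  using computable_compose[of "[e, f, g]" "\<lambda>ys. h (ys ! 0) (ys ! 1) (ys ! 2)" n] assms
  by (simp add: numeral_2_eq_2 numeral_3_eq_3)

section \<open>Arithmetic, case distinction and Boolean connectives\<close>

lemma computable_plus:
  assumes "computable n f" "computable n g"
  shows "computable n (\<lambda>xs. f xs + g xs)"
proof -
  have "computable n (\<lambda>xs. rec_nat (f xs) (\<lambda>m r. Suc r) (g xs))"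
    using assms by (intro computable_rec_nat computable_Suc computable_nth) auto
  moreover have "rec_nat a (\<lambda>m r. Suc r) b = a + b" for a b
    by (induction b) auto
  ultimately show ?thesis by simp
qed

lemma computable_times:
  assumes "computable n f" "computable n g"
  shows "computable n (\<lambda>xs. f xs * g xs)"
proof -
  have "computable n (\<lambda>xs. rec_nat 0 (\<lambda>m r. r + f xs) (g xs))"
    using assms by (intro computable_rec_nat computable_plus computable_nth computable_const
        computable_drop2) auto
  moreover have "rec_nat 0 (\<lambda>m r. r + a) b = a * b" for a b :: nat
    by (induction b) auto
  ultimately show ?thesis by simp
qed

lemma computable_power:
  assumes "computable n f" "computable n g"
  shows "computable n (\<lambda>xs. f xs ^ g xs)"
proof -
  have "computable n (\<lambda>xs. rec_nat 1 (\<lambda>m r. r * f xs) (g xs))"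
    using assms by (intro computable_rec_nat computable_times computable_nth computable_const
        computable_drop2) auto
  moreover have "rec_nat 1 (\<lambda>m r. r * a) b = a ^ b" for a b :: nat
    by (induction b) auto
  ultimately show ?thesis by simp
qed

lemma computable_diff:
  assumes "computable n f" "computable n g"
  shows "computable n (\<lambda>xs. f xs - g xs)"
proof -
  \<comment> \<open>A recursion returning its counter is the predecessor function; iterating it
    gives truncated subtraction.\<close>
  have "computable (Suc (Suc n)) (\<lambda>ys. rec_nat 0 (\<lambda>m r. m) (ys ! 1))"
    by (intro computable_rec_nat computable_nth computable_const) auto
  then have "computable n (\<lambda>xs. rec_nat (f xs) (\<lambda>m r. rec_nat 0 (\<lambda>m r. m) r) (g xs))"
    using assms computable_rec_nat[where s = "\<lambda>m r xs. rec_nat 0 (\<lambda>m r. m) r"] by simp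
  moreover have "rec_nat 0 (\<lambda>m r. m) a = a - 1" for a :: nat
    by (cases a) auto
  moreover have "rec_nat a (\<lambda>m r. r - 1) b = a - b" for a b :: nat
    by (induction b) auto
  ultimately show ?thesis by simp
qed

lemma computable_if:
  assumes "decidable n P" "computable n f" "computable n g"
  shows "computable n (\<lambda>xs. if P xs then f xs else g xs)"
proof -
  \<comment> \<open>Recursion of depth 0 or 1 whose step ignores the accumulator.\<close>
  have "computable n (\<lambda>xs. rec_nat (g xs) (\<lambda>m r. f xs) (of_bool (P xs)))"
    using assms by (intro computable_rec_nat computable_drop2)
  then show ?thesis
    by (rule computable_cong) auto
qed

lemma decidable_not:
  assumes "decidable n P"
  shows "decidable n (\<lambda>xs. \<not> P xs)"
  by (rule computable_cong[OF computable_if[OF assms computable_const[of _ 0] computable_const[of _ 1]]])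
    auto

lemma decidable_conj:
  assumes "decidable n P" "decidable n Q"
  shows "decidable n (\<lambda>xs. P xs \<and> Q xs)"
  by (rule computable_cong[OF computable_if[OF assms computable_const[of _ 0]]]) auto

lemma decidable_disj:
  assumes "decidable n P" "decidable n Q"
  shows "decidable n (\<lambda>xs. P xs \<or> Q xs)"
  by (rule computable_cong[OF computable_if[OF assms(1) computable_const[of _ 1] assms(2)]]) auto

lemma decidable_eq:
  assumes "computable n f" "computable n g"
  shows "decidable n (\<lambda>xs. f xs = g xs)"
proof -
  have "computable n (\<lambda>xs. 1 - ((f xs - g xs) + (g xs - f xs)))"
    using assms by (intro computable_diff computable_plus computable_const)
  then show ?thesis
    by (rule computable_cong) auto
qed

section \<open>Bounded quantifiers and finite tables\<close>

lemma decidable_Bex_less: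
  assumes P: "decidable (Suc n) (\<lambda>ys. P (ys ! 0) (tl ys))" and k: "computable n k"
  shows "decidable n (\<lambda>xs. \<exists>m<k xs. P m xs)"
proof -
  \<comment> \<open>In the recursion the accumulator sits between the bound variable and the
    parameters of \<open>P\<close>; these projections leave it out.\<close>
  let ?gs = "(\<lambda>ys. ys ! 0) # map (\<lambda>i ys. ys ! Suc (Suc i)) [0..<n] :: (nat list \<Rightarrow> nat) list"
  have "decidable (Suc (Suc n)) (\<lambda>ys. P (map (\<lambda>g. g ys) ?gs ! 0) (tl (map (\<lambda>g. g ys) ?gs)))"
    using P by (intro computable_compose[where f = "\<lambda>ys. of_bool (P (ys ! 0) (tl ys))"])
      (auto intro: computable_nth)
  then have "decidable (Suc (Suc n)) (\<lambda>ys. P (ys ! 0) (drop 2 ys))"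
  proof (rule computable_cong)
    fix ys :: "nat list"
    assume "length ys = Suc (Suc n)"
    then have "tl (map (\<lambda>g. g ys) ?gs) = drop 2 ys"
      by (auto intro: nth_equalityI)
    then show "of_bool (P (map (\<lambda>g. g ys) ?gs ! 0) (tl (map (\<lambda>g. g ys) ?gs)))
        = (of_bool (P (ys ! 0) (drop 2 ys)) :: nat)"
      by simp
  qed
  then have "computable n (\<lambda>xs. rec_nat 0 (\<lambda>m r. if P m xs then 1 else r) (k xs))"
    using k by (intro computable_rec_nat computable_if computable_nth computable_const) auto
  moreover have "rec_nat 0 (\<lambda>m r. if P m xs then 1 else r) j = (of_bool (\<exists>m<j. P m xs) :: nat)" for j xs
    by (induction j) (auto simp: less_Suc_eq)
  ultimately show ?thesis by simp
qed

text \<open>No uniformity in \<open>a\<close> is required: each \<open>g a\<close> has its own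
  program, and a nested case distinction over \<open>A\<close> combines them. This makes arbitrary
  functions on finite sets computable.\<close>

lemma computable_finite_cases:
  assumes "finite A" "\<And>a. a \<in> A \<Longrightarrow> computable n (g a)" "computable n f"
  shows "computable n (\<lambda>xs. if f xs \<in> A then g (f xs) xs else 0)"
  using assms(1,2)
proof (induction A rule: finite_induct)
  case empty
  show ?case by (simp add: computable_const)
next
  case (insert a A)
  have "computable n (\<lambda>xs. if f xs = a then g a xs else if f xs \<in> A then g (f xs) xs else 0)"
    by (rule computable_if[OF decidable_eq[OF assms(3) computable_const] insert.prems insert.IH])
      (auto intro: insert.prems)
  then show ?case
    by (rule computable_cong) auto
qed

lemma decidable_mem_finite:
  assumes "finite A" "computable n f"
  shows "decidable n (\<lambda>xs. f xs \<in> A)"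
proof -
  have "computable n (\<lambda>xs. if f xs \<in> A then 1 else 0)"
    using computable_finite_cases[OF assms(1) computable_const assms(2)] .
  then show ?thesis
    by (rule computable_cong) auto
qed

lemmas computable_intros =
  computable_nth computable_nth_drop2 computable_nth_tl computable_nth_tl_tl computable_const computable_Suc
  computable_plus computable_times computable_power computable_diff computable_if
  decidable_not decidable_conj decidable_disj decidable_eq

section \<open>Codes of lists\<close>

lemma computable_prod_encode:
  assumes "computable n f" "computable n g"
  shows "computable n (\<lambda>xs. prod_encode (f xs, g xs))"
proof -
  have "computable n (\<lambda>xs. rec_nat 0 (\<lambda>m r. r + Suc m) (f xs + g xs) + f xs)"
    using assms by (intro computable_rec_nat computable_intros) auto
  moreover have "rec_nat 0 (\<lambda>m r. r + Suc m) k = triangle k" for k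
    by (induction k) auto
  ultimately show ?thesis
    by (simp add: prod_encode_def)
qed

lemma list_decode_cases:
  obtains "k = 0" "list_decode k = []"
  | a j where "k = Suc (prod_encode (a, j))" "list_decode k = a # list_decode j"
proof (cases k)
  case (Suc i)
  then show ?thesis
    using that(2)[of "fst (prod_decode i)" "snd (prod_decode i)"] by (auto split: prod.splits)
qed (use that in auto)

text \<open>Written as a search so that \<open>computable_Least\<close> applies. The disjunct
  \<open>k = 0\<close> makes it total, and the bound on \<open>j\<close> loses nothing since
  \<open>prod_encode\<close> dominates its arguments.\<close>

definition code_hd :: "nat \<Rightarrow> nat" where
  "code_hd k = (LEAST a. k = 0 \<or> (\<exists>j<Suc k. k = Suc (prod_encode (a, j))))"

definition code_tl :: "nat \<Rightarrow> nat" where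
  "code_tl k = (LEAST j. k = 0 \<or> (\<exists>a<Suc k. k = Suc (prod_encode (a, j))))"

lemma prod_encode_le: "a \<le> prod_encode (a, j)" "j \<le> prod_encode (a, j)"
  by (rule le_prod_encode_1, rule le_prod_encode_2)

lemma code_hd_Suc [simp]: "code_hd (Suc (prod_encode (a, j))) = a"
  unfolding code_hd_def
  by (rule Least_equality) (auto simp: prod_encode_eq less_Suc_eq_le le_SucI prod_encode_le)

lemma code_tl_0 [simp]: "code_tl 0 = 0"
  unfolding code_tl_def by (rule Least_equality) auto

lemma code_tl_Suc [simp]: "code_tl (Suc (prod_encode (a, j))) = j"
  unfolding code_tl_def
  by (rule Least_equality) (auto simp: prod_encode_eq less_Suc_eq_le le_SucI prod_encode_le)

lemma computable_code_hd: "computable 1 (\<lambda>xs. code_hd (xs ! 0))"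
proof -
  have "\<exists>a. k = 0 \<or> (\<exists>j<Suc k. k = Suc (prod_encode (a, j)))" for k
    by (cases k rule: list_decode_cases) (auto simp: less_Suc_eq_le le_SucI prod_encode_le)
  then show ?thesis
    unfolding code_hd_def
    by (intro computable_Least computable_intros decidable_Bex_less computable_prod_encode) auto
qed

lemma computable_code_tl: "computable 1 (\<lambda>xs. code_tl (xs ! 0))"
proof -
  have "\<exists>j. k = 0 \<or> (\<exists>a<Suc k. k = Suc (prod_encode (a, j)))" for k
    by (cases k rule: list_decode_cases) (auto simp: less_Suc_eq_le le_SucI prod_encode_le)
  then show ?thesis
    unfolding code_tl_def
    by (intro computable_Least computable_intros decidable_Bex_less computable_prod_encode) auto
qed

text \<open>The \<open>k\<close>-th symbol of a padded word: \<open>0\<close> is the padding symbol, \<open>Suc a\<close> the letter \<open>a\<close>.\<close>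

definition padded :: "nat list \<Rightarrow> nat \<Rightarrow> nat" where
  "padded w k = (if k < length w then Suc (w ! k) else 0)"

text \<open>The symbol is read off after \<open>k\<close> tails. The code \<open>0\<close> of the
  empty list is fixed by \<open>code_tl\<close>, so past the end the padding symbol results.\<close>

lemma computable_padded: "computable 2 (\<lambda>xs. padded (list_decode (xs ! 0)) (xs ! 1))"
proof -
  let ?t = "\<lambda>c k. rec_nat c (\<lambda>m r. code_tl r) k"
  \<comment> \<open>Lets the induction on \<open>k\<close> remove a letter at the front, with
    \<open>c\<close> arbitrary.\<close>
  have shift: "?t (code_tl c) k = code_tl (?t c k)" for c k
    by (induction k) auto
  have eq: "(if ?t c k = 0 then 0 else Suc (code_hd (?t c k))) = padded (list_decode c) k" for c k
  proof (induction k arbitrary: c)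
    case 0
    show ?case
      by (cases c rule: list_decode_cases) (auto simp: padded_def)
  next
    case (Suc k)
    have "(if ?t c (Suc k) = 0 then 0 else Suc (code_hd (?t c (Suc k))))
        = padded (list_decode (code_tl c)) k"
      using Suc[of "code_tl c"] unfolding shift by (simp split: if_splits)
    also have "\<dots> = padded (list_decode c) (Suc k)"
      by (cases c rule: list_decode_cases) (auto simp: padded_def)
    finally show ?case .
  qed
  have tl: "computable n f \<Longrightarrow> computable n (\<lambda>xs. code_tl (f xs))" for n f
    using computable_compose[of "[f]" "\<lambda>ys. code_tl (ys ! 0)"] computable_code_tl by simp
  have hd: "computable n f \<Longrightarrow> computable n (\<lambda>xs. code_hd (f xs))" for n f
    using computable_compose[of "[f]" "\<lambda>ys. code_hd (ys ! 0)"] computable_code_hd by simp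
  have t: "computable 2 (\<lambda>xs. ?t (xs ! 0) (xs ! 1))"
    by (intro computable_rec_nat computable_nth tl) auto
  have "computable 2 (\<lambda>xs. if ?t (xs ! 0) (xs ! 1) = 0 then 0 else Suc (code_hd (?t (xs ! 0) (xs ! 1))))"
    by (rule computable_if[OF decidable_eq[OF t computable_const] computable_const
          computable_Suc[OF hd[OF t]]])
  then show ?thesis
    by (simp only: eq)
qed

text \<open>Makes the code itself a computable bound wherever a word length is called for.\<close>

lemma length_le_code: "length w \<le> list_encode w"
proof (induction w)
  case (Cons a w)
  then show ?case
    using prod_encode_le(2)[where a = a and j = "list_encode w"] by simp
qed simp

lemma prod_encode_mono: "a \<le> b \<Longrightarrow> i \<le> j \<Longrightarrow> prod_encode (a, i) \<le> prod_encode (b, j)"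
  unfolding prod_encode_def triangle_def
  by (auto intro!: add_mono div_le_mono mult_le_mono)

text \<open>This is the code of \<open>replicate l c\<close>; since pairing is monotone, it
  dominates the codes of all words of length at most \<open>l\<close> with letters up to
  \<open>c\<close>.\<close>

definition code_bound :: "nat \<Rightarrow> nat \<Rightarrow> nat" where
  "code_bound c l = rec_nat 0 (\<lambda>_ r. Suc (prod_encode (c, r))) l"

lemma list_encode_le_code_bound:
  "set w \<subseteq> {..c} \<Longrightarrow> length w \<le> l \<Longrightarrow> list_encode w \<le> code_bound c l"
proof (induction w arbitrary: l)
  case (Cons a w)
  then show ?case
    by (cases l) (auto simp: code_bound_def intro!: prod_encode_mono)
qed simp

lemma computable_code_bound:
  "computable n f \<Longrightarrow> computable n (\<lambda>xs. code_bound c (f xs))"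
  unfolding code_bound_def
  by (intro computable_rec_nat computable_intros computable_prod_encode) auto

section \<open>Two-tape automata on padded words\<close>

text \<open>The number of steps is independent of the word lengths, so that automata on different
  pairs of words can be run in lockstep.\<close>

definition run :: "(nat \<Rightarrow> nat \<Rightarrow> nat \<Rightarrow> nat) \<Rightarrow> nat \<Rightarrow> nat list \<Rightarrow> nat list \<Rightarrow> nat \<Rightarrow> nat" where
  "run d q u v k = rec_nat q (\<lambda>m s. d s (padded u m) (padded v m)) k"

lemma run_simps [simp]:
  "run d q u v 0 = q"
  "run d q u v (Suc k) = d (run d q u v k) (padded u k) (padded v k)"
  by (simp_all add: run_def)

lemma run_padding:
  assumes "\<And>s. d s 0 0 = s" "length u \<le> k" "length v \<le> k" "k \<le> l"
  shows "run d q u v l = run d q u v k"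
  using assms(4) by (induction l rule: dec_induct) (use assms in \<open>auto simp: padded_def\<close>)

lemma run_swap: "run (\<lambda>s a b. d s b a) q v u k = run d q u v k"
  by (induction k) auto

text \<open>A one-tape automaton is a two-tape one that ignores the second tape and pauses on
  padding of the first.\<close>

lemma run_fst: "length u \<le> k \<Longrightarrow> (\<And>s b. d s 0 b = s) \<Longrightarrow> (\<And>s a b. d s (Suc a) b = f s a) \<Longrightarrow>
  run d q u v k = foldl f q u"
proof -
  assume k: "length u \<le> k" and d: "\<And>s b. d s 0 b = s" "\<And>s a b. d s (Suc a) b = f s a"
  have "run d q u v k = foldl f q (take k u)" for k
    by (induction k) (auto simp: d padded_def take_Suc_conv_app_nth)
  with k show ?thesis by simp
qed

text \<open>By \<open>length_le_code\<close> the sum of the two codes is enough steps to read both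
  words; the surplus steps read padding only.\<close>

lemma computable_run:
  assumes d: "computable 3 (\<lambda>xs. d (xs ! 0) (xs ! 1) (xs ! 2))"
    and stay: "\<And>s. d s 0 0 = s"
  shows "computable 3 (\<lambda>xs. run d (xs ! 0) (list_decode (xs ! 1)) (list_decode (xs ! 2)) (xs ! 1 + xs ! 2))"
  unfolding run_def
  by (intro computable_rec_nat computable_intros computable_apply3[OF d]
      computable_apply2[OF computable_padded]) auto

lemma computable_foldl:
  assumes f: "computable 2 (\<lambda>xs. f (xs ! 0) (xs ! 1))"
  shows "computable 2 (\<lambda>xs. foldl f (xs ! 0) (list_decode (xs ! 1)))"
proof -
  define d where "d = (\<lambda>s a b :: nat. if a = 0 then s else f s (a - 1))"
  have "computable 3 (\<lambda>xs. d (xs ! 0) (xs ! 1) (xs ! 2))"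
    unfolding d_def by (intro computable_if computable_intros computable_apply2[OF f]) auto
  then have "computable 3 (\<lambda>xs. run d (xs ! 0) (list_decode (xs ! 1)) (list_decode (xs ! 2)) (xs ! 1 + xs ! 2))"
    by (rule computable_run) (simp add: d_def)
  then have "computable 2 (\<lambda>xs. run d (xs ! 0) (list_decode (xs ! 1)) (list_decode 0) (xs ! 1 + 0))"
    by (rule computable_apply3) (intro computable_intros; simp)+
  moreover have "run d q (list_decode k) (list_decode 0) (k + 0) = foldl f q (list_decode k)" for q k
    using length_le_code[of "list_decode k"] by (intro run_fst) (auto simp: d_def)
  ultimately show ?thesis by simp
qed

text \<open>Finiteness is asked of the visited states only, so \<open>d\<close> accepts all natural
  numbers as letters. Since double padding changes no state, acceptance can be read at any time
  after both words have ended.\<close>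

definition automatic_rel :: "(nat list \<Rightarrow> nat list \<Rightarrow> bool) \<Rightarrow> bool" where
  "automatic_rel E \<longleftrightarrow> (\<exists>d q F S.
     computable 3 (\<lambda>xs. d (xs ! 0) (xs ! 1) (xs ! 2)) \<and> (\<forall>s. d s 0 0 = s) \<and>
     finite S \<and> (\<forall>u v k. run d q u v k \<in> S) \<and>
     (\<forall>u v k. length u \<le> k \<longrightarrow> length v \<le> k \<longrightarrow> (E u v \<longleftrightarrow> run d q u v k \<in> F)))"

lemma automatic_rel_swap:
  assumes "automatic_rel E"
  shows "automatic_rel (\<lambda>u v. E v u)"
proof -
  obtain d q F S where d: "computable 3 (\<lambda>xs. d (xs ! 0) (xs ! 1) (xs ! 2))" "\<forall>s. d s 0 0 = s"
    "finite S" "\<forall>u v k. run d q u v k \<in> S"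
    "\<forall>u v k. length u \<le> k \<longrightarrow> length v \<le> k \<longrightarrow> (E u v \<longleftrightarrow> run d q u v k \<in> F)"
    using assms unfolding automatic_rel_def by blast
  have "computable 3 (\<lambda>xs. d (xs ! 0) (xs ! 2) (xs ! 1))"
    using d(1) by (rule computable_apply3) (intro computable_intros; simp)+
  with d(2-) show ?thesis
    unfolding automatic_rel_def
    by (intro exI[of _ "\<lambda>s a b. d s b a"] exI[of _ q] exI[of _ F] exI[of _ S]) (simp add: run_swap[of d])
qed

lemma decidable_automatic_rel:
  assumes "automatic_rel E"
  shows "decidable 2 (\<lambda>xs. E (list_decode (xs ! 0)) (list_decode (xs ! 1)))"
proof -
  obtain d q F S where d: "computable 3 (\<lambda>xs. d (xs ! 0) (xs ! 1) (xs ! 2))" "\<forall>s. d s 0 0 = s"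
    and S: "finite S" "\<forall>u v k. run d q u v k \<in> S"
    and E: "\<forall>u v k. length u \<le> k \<longrightarrow> length v \<le> k \<longrightarrow> (E u v \<longleftrightarrow> run d q u v k \<in> F)"
    using assms unfolding automatic_rel_def by blast
  have "computable 3 (\<lambda>xs. run d (xs ! 0) (list_decode (xs ! 1)) (list_decode (xs ! 2)) (xs ! 1 + xs ! 2))"
    using d by (intro computable_run) auto
  then have "computable 2 (\<lambda>xs. run d q (list_decode (xs ! 0)) (list_decode (xs ! 1)) (xs ! 0 + xs ! 1))"
    by (rule computable_apply3) (intro computable_intros; simp)+
  \<comment> \<open>Nothing is known about \<open>F\<close> itself, but \<open>F \<inter> S\<close>
    is finite and hence decidable.\<close>
  then have "decidable 2 (\<lambda>xs. run d q (list_decode (xs ! 0)) (list_decode (xs ! 1)) (xs ! 0 + xs ! 1) \<in> F \<inter> S)"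
    using S by (intro decidable_mem_finite) auto
  moreover have "run d q (list_decode a) (list_decode b) (a + b) \<in> F \<inter> S \<longleftrightarrow>
      E (list_decode a) (list_decode b)" for a b
    using E[rule_format, of "list_decode a" "a + b" "list_decode b"] S(2)
      length_le_code[of "list_decode a"] length_le_code[of "list_decode b"] by simp
  ultimately show ?thesis by simp
qed

lemma automatic_relI:
  assumes "finite \<Sigma>" "finite Q" "q \<in> Q" "F \<subseteq> Q"
    and closed: "\<And>s a b. s \<in> Q \<Longrightarrow> a \<in> insert 0 (Suc ` \<Sigma>) \<Longrightarrow> b \<in> insert 0 (Suc ` \<Sigma>) \<Longrightarrow> e s a b \<in> Q"
    and E: "\<And>u v. E u v \<Longrightarrow> u \<in> lists \<Sigma> \<and> v \<in> lists \<Sigma>"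
      "\<And>u v. u \<in> lists \<Sigma> \<Longrightarrow> v \<in> lists \<Sigma> \<Longrightarrow> E u v \<longleftrightarrow> run e q u v (max (length u) (length v)) \<in> F"
  shows "automatic_rel E"
proof -
  let ?A = "insert 0 (Suc ` \<Sigma>)"
  text \<open>State \<open>0\<close> is a sink that catches letters outside \<open>\<Sigma>\<close>; the state \<open>s\<close> becomes \<open>Suc s\<close>.\<close>
  define d where "d = (\<lambda>s a b. if a = 0 \<and> b = 0 then s else
      if s \<in> Suc ` Q then if a \<in> ?A then if b \<in> ?A then Suc (e (s - 1) a b) else 0 else 0 else 0)"
  \<comment> \<open>An arbitrary \<open>e\<close> on finitely many states and letters is a table:
    three nested finite case distinctions.\<close>
  have "computable 3 (\<lambda>xs. if xs ! 0 \<in> Suc ` Q then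
      (\<lambda>s xs. if xs ! 1 \<in> ?A then
        (\<lambda>a xs. if xs ! 2 \<in> ?A then (\<lambda>b xs. Suc (e (s - 1) a b)) (xs ! 2) xs else 0) (xs ! 1) xs else 0)
      (xs ! 0) xs else 0)"
    by (rule computable_finite_cases; (rule computable_finite_cases)?; (rule computable_finite_cases)?)
      (use assms in \<open>auto intro!: computable_intros\<close>)
  from computable_if[OF _ _ this] have comp: "computable 3 (\<lambda>xs. d (xs ! 0) (xs ! 1) (xs ! 2))"
    unfolding d_def by this (intro computable_intros; simp)+
  have stay: "d s 0 0 = s" for s
    by (simp add: d_def)
  have S: "run d (Suc q) u v k \<in> insert 0 (Suc ` Q)" for u v k
    by (induction k) (use assms(3) closed in \<open>auto simp: d_def\<close>)
  \<comment> \<open>Until the longer word ends the two letters are never both padding, so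
    \<open>d\<close> follows \<open>e\<close>.\<close>
  have good: "run d (Suc q) u v k = Suc (run e q u v k) \<and> run e q u v k \<in> Q"
    if "u \<in> lists \<Sigma>" "v \<in> lists \<Sigma>" "k \<le> max (length u) (length v)" for u v k
    using that(3)
  proof (induction k)
    case (Suc k)
    have *: "padded u k \<in> ?A" "padded v k \<in> ?A"
      using that by (auto simp: padded_def in_lists_conv_set)
    have "\<not> (padded u k = 0 \<and> padded v k = 0)"
      using Suc.prems by (auto simp: padded_def)
    with Suc * show ?case
      using closed[OF _ *] by (auto simp: d_def)
  qed (use assms(3) in auto)
  \<comment> \<open>A letter outside \<open>\<Sigma>\<close> sends every state to the sink, and the
    sink is never left.\<close>
  have bad: "run d (Suc q) u v k = 0"
    if w: "i < length u \<and> u ! i \<notin> \<Sigma> \<or> i < length v \<and> v ! i \<notin> \<Sigma>" and "i < k" for u v i k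
    using \<open>i < k\<close>
  proof (induction k)
    case (Suc k)
    then consider "i < k" | "i = k" by linarith
    then show ?case
    proof cases
      case 1
      with Suc show ?thesis by (auto simp: d_def)
    next
      case 2
      then show ?thesis using w by (auto simp: d_def padded_def)
    qed
  qed auto
  have "E u v \<longleftrightarrow> run d (Suc q) u v k \<in> Suc ` F" if k: "length u \<le> k" "length v \<le> k" for u v k
  proof (cases "u \<in> lists \<Sigma> \<and> v \<in> lists \<Sigma>")
    case True
    have "run d (Suc q) u v k = run d (Suc q) u v (max (length u) (length v))"
      using stay k by (intro run_padding) auto
    then show ?thesis
      using True E(2) good[of u v "max (length u) (length v)"] by auto
  next
    case False
    then have "(\<exists>i<length u. u ! i \<notin> \<Sigma>) \<or> (\<exists>i<length v. v ! i \<notin> \<Sigma>)"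
      by (auto simp: in_lists_conv_set in_set_conv_nth)
    then obtain i where i: "i < length u \<and> u ! i \<notin> \<Sigma> \<or> i < length v \<and> v ! i \<notin> \<Sigma>"
      by blast
    then have "run d (Suc q) u v k = 0"
      using k by (intro bad[of i]) auto
    then show ?thesis
      using False E(1) by auto
  qed
  then show ?thesis
    unfolding automatic_rel_def using comp stay S \<open>finite Q\<close>
    by (intro exI[of _ d] exI[of _ "Suc q"] exI[of _ "Suc ` F"] exI[of _ "insert 0 (Suc ` Q)"]) auto
qed

section \<open>Convolutions as runs on padded words\<close>

fun symbol :: "nat \<Rightarrow> nat option" where
  "symbol 0 = None"
| "symbol (Suc a) = Some a"

lemma convolution_pair:
  "convolution [u, v] = map (\<lambda>k. [symbol (padded u k), symbol (padded v k)]) [0..<max (length u) (length v)]"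
  by (auto simp: convolution_def padded_def)

lemma foldl_convolution_pair:
  "foldl \<delta> q (convolution [u, v]) = run (\<lambda>s a b. \<delta> s [symbol a, symbol b]) q u v (max (length u) (length v))"
proof -
  have "foldl \<delta> q (map (\<lambda>k. [symbol (padded u k), symbol (padded v k)]) [0..<n])
      = run (\<lambda>s a b. \<delta> s [symbol a, symbol b]) q u v n" for n
    by (induction n) auto
  then show ?thesis
    by (simp only: convolution_pair)
qed

text \<open>The length is recovered as the first position carrying the padding symbol.\<close>

lemma padded_inject: "padded u = padded v \<longleftrightarrow> u = v"
proof
  assume eq: "padded u = padded v"
  have "length u = length v"
    using fun_cong[OF eq, of "length u"] fun_cong[OF eq, of "length v"]
    by (auto simp: padded_def split: if_splits)
  moreover have "u ! k = v ! k" if "k < length u" for k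
    using fun_cong[OF eq, of k] that \<open>length u = length v\<close> by (simp add: padded_def)
  ultimately show "u = v"
    by (rule nth_equalityI)
qed simp

text \<open>Recognizability only speaks about the image of a relation under
  \<open>convolution\<close>; injectivity recovers the relation from it.\<close>

lemma convolution_pair_inject:
  fixes u v u' v' :: "nat list"
  shows "convolution [u, v] = convolution [u', v'] \<longleftrightarrow> u = u' \<and> v = v'"
proof
  assume eq: "convolution [u, v] = convolution [u', v']"
  let ?n = "max (length u) (length v)"
  have n: "?n = max (length u') (length v')"
    using arg_cong[OF eq, of length] by (simp add: convolution_pair)
  have inj: "symbol a = symbol b \<longleftrightarrow> a = b" for a b
    by (cases a; cases b) auto
  have "padded u k = padded u' k \<and> padded v k = padded v' k" for k
  proof (cases "k < ?n")
    case True
    then show ?thesis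
      using arg_cong[OF eq, of "\<lambda>c. c ! k"] n by (simp add: convolution_pair inj)
  next
    case False
    then have "\<not> k < length u" "\<not> k < length v" "\<not> k < length u'" "\<not> k < length v'"
      using n by auto
    then show ?thesis by (simp add: padded_def)
  qed
  then show "u = u' \<and> v = v'"
    by (simp add: padded_inject[symmetric] fun_eq_iff)
qed auto

lemma automatic_rel_fa_recognizable:
  assumes "finite \<Sigma>" and R: "fa_recognizable \<Sigma> 2 {[u, v] | u v. E u v}"
  shows "automatic_rel E"
proof -
  let ?C = "conv_alphabet \<Sigma> 2"
  obtain Q :: "nat set" and q F \<delta> where Q: "finite Q" "q \<in> Q" "F \<subseteq> Q" "\<forall>s\<in>Q. \<forall>a\<in>?C. \<delta> s a \<in> Q"
    and L: "convolution ` {[u, v] | u v. E u v} = {w \<in> lists ?C. foldl \<delta> q w \<in> F}"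
    using conjunct2[OF R[unfolded fa_recognizable_def]] unfolding regular_language_def by metis
  have C: "[symbol a, symbol b] \<in> ?C" if "a \<in> insert 0 (Suc ` \<Sigma>)" "b \<in> insert 0 (Suc ` \<Sigma>)" for a b
    using that by (auto simp: conv_alphabet_def)
  show ?thesis
  proof (rule automatic_relI[OF assms(1) Q(1-3)])
    fix u v
    show "u \<in> lists \<Sigma> \<and> v \<in> lists \<Sigma>" if "E u v"
      using R that by (fastforce simp: fa_recognizable_def)
    assume uv: "u \<in> lists \<Sigma>" "v \<in> lists \<Sigma>"
    have "E u v \<longleftrightarrow> convolution [u, v] \<in> convolution ` {[u, v] | u v. E u v}"
      by (auto simp: image_iff convolution_pair_inject)
    moreover have "convolution [u, v] \<in> lists ?C"
      unfolding convolution_pair using uv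
      by (auto simp: padded_def in_lists_conv_set conv_alphabet_def)
    ultimately show "E u v \<longleftrightarrow> run (\<lambda>s a b. \<delta> s [symbol a, symbol b]) q u v (max (length u) (length v)) \<in> F"
      unfolding L by (simp add: foldl_convolution_pair)
  qed (use Q(4) C in auto)
qed

text \<open>Casts the unary condition \<open>u \<in> R\<close> as a binary constraint; the automaton
  works on the first tape alone.\<close>

lemma automatic_rel_regular_language:
  assumes "finite \<Sigma>" "regular_language \<Sigma> R"
  shows "automatic_rel (\<lambda>u v. u \<in> R \<and> v \<in> lists \<Sigma>)"
proof -
  obtain Q :: "nat set" and q F \<delta> where Q: "finite Q" "q \<in> Q" "F \<subseteq> Q" "\<forall>s\<in>Q. \<forall>a\<in>\<Sigma>. \<delta> s a \<in> Q"
    and L: "R = {w \<in> lists \<Sigma>. foldl \<delta> q w \<in> F}"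
    using assms(2) unfolding regular_language_def by metis
  define e where "e = (\<lambda>s a b :: nat. if a = 0 then s else \<delta> s (a - 1))"
  have "run e q u v (max (length u) (length v)) = foldl \<delta> q u" for u v
    by (rule run_fst) (auto simp: e_def)
  then show ?thesis
    using Q(4) by (intro automatic_relI[OF assms(1) Q(1-3), of e]) (auto simp: L e_def)
qed

section \<open>Pumping finite systems of automatic constraints\<close>

definition recognizes ::
    "nat \<Rightarrow> (nat \<Rightarrow> nat \<Rightarrow> nat \<Rightarrow> nat) \<Rightarrow> nat \<Rightarrow> nat set \<Rightarrow> (nat list \<Rightarrow> nat list \<Rightarrow> bool) \<Rightarrow> bool" where
  "recognizes N d q F E \<longleftrightarrow> (\<forall>u v k. run d q u v k < N) \<and>
     (\<forall>u v k. length u \<le> k \<longrightarrow> length v \<le> k \<longrightarrow> (E u v \<longleftrightarrow> run d q u v k \<in> F))"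

text \<open>Stated for all larger bounds so that finitely many relations can share one.\<close>

lemma automatic_rel_recognizes:
  assumes "automatic_rel E"
  shows "\<exists>N. \<forall>M\<ge>N. \<exists>d q F. recognizes M d q F E"
proof -
  obtain d q F S where S: "finite S" "\<forall>u v k. run d q u v k \<in> S"
    and E: "\<forall>u v k. length u \<le> k \<longrightarrow> length v \<le> k \<longrightarrow> (E u v \<longleftrightarrow> run d q u v k \<in> F)"
    using assms unfolding automatic_rel_def by blast
  obtain N where "\<forall>s\<in>S. s < N"
    using S(1) finite_nat_set_iff_bounded by auto
  with S(2) E have "recognizes M d q F E" if "M \<ge> N" for M
    unfolding recognizes_def using that less_le_trans by blast
  then show ?thesis by blast
qed

definition excise :: "nat \<Rightarrow> nat \<Rightarrow> nat list \<Rightarrow> nat list" where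
  "excise i j w = take i w @ drop j w"

text \<open>On the infinite padded word, excision deletes exactly the positions from
  \<open>i\<close> to \<open>j - 1\<close>, even if the word ends before \<open>i\<close> or between
  the two.\<close>

lemma padded_excise: "i \<le> j \<Longrightarrow> padded (excise i j w) k = padded w (if k < i then k else k + (j - i))"
  by (auto simp: padded_def excise_def nth_append min_def add.commute)

text \<open>Before \<open>i\<close> the letters are unchanged. Equal states at \<open>i\<close> and
  \<open>j\<close> then let the new run continue as the old one does from \<open>j\<close>
  on.\<close>

lemma run_excise:
  assumes "i \<le> j" "run d q u v i = run d q u v j" "i \<le> k"
  shows "run d q (excise i j u) (excise i j v) k = run d q u v (k + (j - i))"
  using assms(3)
proof (induction k rule: dec_induct)
  case base
  have "run d q (excise i j u) (excise i j v) k = run d q u v k" if "k \<le> i" for k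
    using that by (induction k) (use assms(1) in \<open>auto simp: padded_excise\<close>)
  then show ?case
    using assms by simp
qed (use assms(1) in \<open>simp add: padded_excise\<close>)

lemma length_excise: "i \<le> j \<Longrightarrow> j \<le> l \<Longrightarrow> length w \<le> l \<Longrightarrow> length (excise i j w) \<le> l - (j - i)"
  by (auto simp: excise_def)

text \<open>
  One map \<open>\<phi>\<close> serves all constraints, so that equalities between the words survive.
\<close>

lemma pump_constraints:
  assumes "\<forall>(E, u, v)\<in>set cs. E u v \<and> (\<exists>d q F. recognizes N d q F E)"
  shows "\<exists>\<phi>. \<forall>(E, u, v)\<in>set cs. E (\<phi> u) (\<phi> v) \<and> length (\<phi> u) \<le> N ^ length cs"
proof -
  \<comment> \<open>Induction on a common length bound \<open>l\<close> for all words, which starts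
    from the sum of all lengths.\<close>
  let ?good = "\<lambda>l cs. \<forall>(E, u, v)\<in>set cs.
    E u v \<and> (\<exists>d q F. recognizes N d q F E) \<and> length u \<le> l \<and> length v \<le> l"
  have "?good l cs \<Longrightarrow> ?thesis" for l
  proof (induction l arbitrary: cs rule: less_induct)
    case (less l)
    show ?case
    proof (cases "l \<le> N ^ length cs")
      case True
      then show ?thesis
        using less.prems by (intro exI[of _ id]) fastforce
    next
      case False
      have "\<forall>E\<in>fst ` set cs. \<exists>d q F. recognizes N d q F E"
        using less.prems by fastforce
      then obtain d q F where rec: "\<forall>E\<in>fst ` set cs. recognizes N (d E) (q E) (F E) E"
        by metis
      \<comment> \<open>The joint state of all automata at time \<open>t\<close>. There are
        \<open>l + 1\<close> times but at most \<open>N ^ length cs\<close> vectors, so some vector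
        repeats when \<open>l\<close> exceeds that number.\<close>
      define st where "st = (\<lambda>t. map (\<lambda>(E, u, v). run (d E) (q E) u v t) cs)"
      have "st ` {..l} \<subseteq> {ys. set ys \<subseteq> {..<N} \<and> length ys = length cs}"
        using rec by (fastforce simp: st_def recognizes_def)
      then have "card (st ` {..l}) \<le> card {ys. set ys \<subseteq> {..<N} \<and> length ys = length cs}"
        by (intro card_mono finite_lists_length_eq finite_lessThan)
      also have "\<dots> = N ^ length cs"
        by (simp add: card_lists_length_eq)
      finally have "card (st ` {..l}) \<le> N ^ length cs" .
      then have "\<not> inj_on st {..l}"
        using False by (intro pigeonhole) simp
      then obtain i j where ij: "i < j" "j \<le> l" "st i = st j"
        unfolding inj_on_def by (metis atMost_iff linorder_neqE_nat)
      let ?exc = "\<lambda>(E, u, v). (E, excise i j u, excise i j v)"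
      have "E (excise i j u) (excise i j v)" if c: "(E, u, v) \<in> set cs" for E u v
      proof -
        have len: "length u \<le> l" "length v \<le> l" and "E u v"
          using less.prems c by auto
        have r: "recognizes N (d E) (q E) (F E) E"
          using rec c by force
        have "run (d E) (q E) u v i = run (d E) (q E) u v j"
          using ij(3) c by (auto simp: st_def)
        \<comment> \<open>Time \<open>l\<close> in the new run corresponds to time
          \<open>l + (j - i)\<close> in the old one; both are past the ends of the words concerned,
          so both runs decide acceptance.\<close>
        then have "run (d E) (q E) (excise i j u) (excise i j v) l = run (d E) (q E) u v (l + (j - i))"
          using ij by (intro run_excise) auto
        moreover have "length (excise i j u) \<le> l" "length (excise i j v) \<le> l"
          using length_excise[of i j l u] length_excise[of i j l v] ij len by auto
        moreover have "run (d E) (q E) u v (l + (j - i)) \<in> F E"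
          using r \<open>E u v\<close> len unfolding recognizes_def by (metis trans_le_add1)
        ultimately show ?thesis
          using r unfolding recognizes_def by metis
      qed
      then have "?good (l - (j - i)) (map ?exc cs)"
        using less.prems ij length_excise[of i j l] by fastforce
      moreover have "l - (j - i) < l"
        using ij by auto
      ultimately obtain \<phi> where "\<forall>(E, u, v)\<in>set (map ?exc cs).
          E (\<phi> u) (\<phi> v) \<and> length (\<phi> u) \<le> N ^ length (map ?exc cs)"
        using less.IH by blast
      then show ?thesis
        by (intro exI[of _ "\<phi> \<circ> excise i j"]) fastforce
    qed
  qed
  moreover have "?good (sum_list (map (\<lambda>(E, u, v). length u + length v) cs)) cs"
  proof (intro ballI)
    fix c
    assume c: "c \<in> set cs"
    obtain E u v where [simp]: "c = (E, u, v)"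
      by (cases c)
    have "length u + length v \<le> sum_list (map (\<lambda>(E, u, v). length u + length v) cs)"
      using c by (intro member_le_sum_list) force+
    then show "case c of (E, u, v) \<Rightarrow> E u v \<and> (\<exists>d q F. recognizes N d q F E) \<and>
        length u \<le> sum_list (map (\<lambda>(E, u, v). length u + length v) cs) \<and>
        length v \<le> sum_list (map (\<lambda>(E, u, v). length u + length v) cs)"
      using assms c by auto
  qed
  ultimately show ?thesis .
qed

lemma finite_automatic_rel_recognizes:
  assumes "finite Es" "\<And>E. E \<in> Es \<Longrightarrow> automatic_rel E"
  shows "\<exists>N. \<forall>E\<in>Es. \<exists>d q F. recognizes N d q F E"
proof -
  have "\<forall>E\<in>Es. \<exists>N. \<forall>M\<ge>N. \<exists>d q F. recognizes M d q F E"
    using assms(2) automatic_rel_recognizes by blast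
  then obtain N where N: "\<forall>E\<in>Es. \<forall>M\<ge>N E. \<exists>d q F. recognizes M d q F E"
    by (rule bchoice[THEN exE])
  \<comment> \<open>The sum of the individual bounds serves as the common bound.\<close>
  have "N E \<le> sum N Es" if "E \<in> Es" for E
    using assms(1) that by (intro member_le_sum) auto
  with N show ?thesis by blast
qed

section \<open>Conjugation in a graph biautomatic group\<close>

locale biautomatic_group = group G for G :: "('a, 'm) monoid_scheme" (structure) +
  fixes X :: "'a set" and \<Sigma> :: "nat set" and R nu
  assumes finite_X: "finite X" and X_carrier: "X \<subseteq> carrier G"
    and biautomatic: "graph_biautomatic_structure G X \<Sigma> R nu"
begin

text \<open>The flag selects the side. Left moves use inverses so that a closed cycle of moves
  expresses the conjugacy equation.\<close>

fun move :: "'a \<Rightarrow> bool \<times> 'a \<Rightarrow> 'a" where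
  "move g (True, x) = g \<otimes> x"
| "move g (False, x) = inv x \<otimes> g"

definition rel :: "bool \<times> 'a \<Rightarrow> nat list \<Rightarrow> nat list \<Rightarrow> bool" where
  "rel l u v \<longleftrightarrow> u \<in> R \<and> v \<in> R \<and> nu v = move (nu u) l"

definition step :: "nat list \<Rightarrow> bool \<times> 'a \<Rightarrow> nat list" where
  "step u l = inv_into R nu (move (nu u) l)"

lemma finite_alphabet: "finite \<Sigma>"
  and R_regular: "regular_language \<Sigma> R"
  and nu_bij: "bij_betw nu R (carrier G)"
  using biautomatic unfolding graph_biautomatic_structure_def by auto

lemma R_words: "R \<subseteq> lists \<Sigma>"
  using R_regular by (auto simp: regular_language_def)

lemma nu_closed: "u \<in> R \<Longrightarrow> nu u \<in> carrier G"
  using nu_bij by (auto simp: bij_betw_def)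

lemma move_closed: "g \<in> carrier G \<Longrightarrow> snd l \<in> X \<Longrightarrow> move g l \<in> carrier G"
  using X_carrier by (cases l; cases "fst l") auto

text \<open>Bijectivity of \<open>nu\<close> makes each constraint the graph of a function on
  \<open>R\<close>; hence words that satisfy a chain of constraints are determined by the first
  one.\<close>

lemma rel_iff_step:
  assumes "u \<in> R" "snd l \<in> X"
  shows "rel l u v \<longleftrightarrow> v = step u l"
proof -
  have g: "move (nu u) l \<in> nu ` R"
    using assms move_closed nu_closed nu_bij by (simp add: bij_betw_def)
  show ?thesis
    using assms(1) g inv_into_into[OF g] f_inv_into_f[OF g] nu_bij
    unfolding rel_def step_def bij_betw_def inj_on_def by metis
qed

lemma step_closed: "u \<in> R \<Longrightarrow> snd l \<in> X \<Longrightarrow> step u l \<in> R"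
  and nu_step: "u \<in> R \<Longrightarrow> snd l \<in> X \<Longrightarrow> nu (step u l) = move (nu u) l"
  using rel_iff_step unfolding rel_def by blast+

lemma automatic_rel_rel:
  assumes "snd l \<in> X"
  shows "automatic_rel (rel l)"
proof -
  obtain b x where [simp]: "l = (b, x)"
    by (cases l)
  have x: "x \<in> X" "x \<in> carrier G"
    using assms X_carrier by auto
  show ?thesis
  proof (cases b)
    case True
    have "rel l = (\<lambda>u v. u \<in> R \<and> v \<in> R \<and> nu u \<otimes> x = nu v)"
      using True by (auto simp: rel_def fun_eq_iff)
    then show ?thesis
      using biautomatic x(1) automatic_rel_fa_recognizable[OF finite_alphabet]
      unfolding graph_biautomatic_structure_def by simp
  next
    case False
    \<comment> \<open>The inverse of \<open>x\<close> may lie outside \<open>X\<close>, but left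
      multiplication by it is the converse of left multiplication by \<open>x\<close>, so it
      suffices to swap the tapes.\<close>
    have "rel l = (\<lambda>u v. v \<in> R \<and> u \<in> R \<and> x \<otimes> nu v = nu u)"
      using False x(2) nu_closed by (auto simp: rel_def fun_eq_iff m_assoc[symmetric] inv_solve_left)
    moreover have "automatic_rel (\<lambda>v u. v \<in> R \<and> u \<in> R \<and> x \<otimes> nu v = nu u)"
      using biautomatic x(1) automatic_rel_fa_recognizable[OF finite_alphabet]
      unfolding graph_biautomatic_structure_def by simp
    ultimately show ?thesis
      by (simp add: automatic_rel_swap)
  qed
qed

lemma foldl_step:
  assumes "u \<in> R" "snd ` set ls \<subseteq> X"
  shows "foldl step u ls \<in> R \<and> nu (foldl step u ls) = foldl move (nu u) ls"
  using assms by (induction ls arbitrary: u) (simp_all add: step_closed nu_step)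

lemma word_value_closed: "w \<in> lists X \<Longrightarrow> word_value G w \<in> carrier G"
  by (induction w) (use X_carrier in \<open>auto simp: word_value_def\<close>)

lemma word_value_Cons: "word_value G (x # w) = x \<otimes> word_value G w"
  by (simp add: word_value_def)

section \<open>Conjugators as fixed points\<close>

lemma foldl_move_right:
  "w \<in> lists X \<Longrightarrow> g \<in> carrier G \<Longrightarrow> foldl move g (map (Pair True) w) = g \<otimes> word_value G w"
proof (induction w arbitrary: g)
  case (Cons x w)
  then have "x \<in> carrier G" "word_value G w \<in> carrier G"
    using X_carrier word_value_closed by auto
  with Cons show ?case
    by (simp add: word_value_Cons m_assoc)
qed (simp add: word_value_def)

text \<open>Multiplying on the left by the inverse letters in the order of \<open>w\<close> reverses
  them, as the inverse of a product does.\<close>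

lemma foldl_move_left:
  "w \<in> lists X \<Longrightarrow> g \<in> carrier G \<Longrightarrow> foldl move g (map (Pair False) w) = inv (word_value G w) \<otimes> g"
proof (induction w arbitrary: g)
  case (Cons x w)
  then have "x \<in> carrier G" "word_value G w \<in> carrier G"
    using X_carrier word_value_closed by auto
  with Cons show ?case
    by (simp add: word_value_Cons m_assoc inv_mult_group)
qed (simp add: word_value_def)

definition conjugation :: "'a list \<Rightarrow> 'a list \<Rightarrow> (bool \<times> 'a) list" where
  "conjugation p q = map (Pair True) q @ map (Pair False) p"

lemma conjugation_letters: "p \<in> lists X \<Longrightarrow> q \<in> lists X \<Longrightarrow> snd ` set (conjugation p q) \<subseteq> X"
  by (auto simp: conjugation_def)

text \<open>Every conjugator is \<open>nu u\<close> for a unique \<open>u \<in> R\<close>. With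
  \<open>g = nu u\<close>, returning to \<open>u\<close> means
  \<open>inv a \<otimes> (g \<otimes> b) = g\<close>, which rearranges to the conjugacy
  equation.\<close>

lemma conjugate_iff_fixpoint:
  assumes p: "p \<in> lists X" and q: "q \<in> lists X"
  shows "conjugate_in G (word_value G p) (word_value G q) \<longleftrightarrow>
    (\<exists>u\<in>R. foldl step u (conjugation p q) = u)"
proof -
  let ?a = "word_value G p" and ?b = "word_value G q"
  have ab: "?a \<in> carrier G" "?b \<in> carrier G"
    using p q by (auto intro: word_value_closed)
  have fix_iff: "foldl step u (conjugation p q) = u \<longleftrightarrow> ?b = inv (nu u) \<otimes> ?a \<otimes> nu u" if u: "u \<in> R" for u
  proof -
    have g: "nu u \<in> carrier G"
      using u by (rule nu_closed)
    have f: "foldl step u (conjugation p q) \<in> R"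
      "nu (foldl step u (conjugation p q)) = foldl move (nu u) (conjugation p q)"
      using foldl_step[OF u conjugation_letters[OF p q]] by auto
    have "foldl step u (conjugation p q) = u \<longleftrightarrow> nu (foldl step u (conjugation p q)) = nu u"
      using nu_bij f(1) u by (auto simp: bij_betw_def inj_on_def)
    also have "\<dots> \<longleftrightarrow> inv ?a \<otimes> (nu u \<otimes> ?b) = nu u"
      unfolding f(2) using p q g ab by (simp add: conjugation_def foldl_move_right foldl_move_left)
    also have "\<dots> \<longleftrightarrow> nu u \<otimes> ?b = ?a \<otimes> nu u"
      using g ab by (metis inv_solve_left m_closed)
    also have "\<dots> \<longleftrightarrow> ?b = inv (nu u) \<otimes> ?a \<otimes> nu u"
      using g ab by (metis inv_solve_left m_assoc m_closed inv_closed)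
    finally show ?thesis .
  qed
  have "conjugate_in G ?a ?b \<longleftrightarrow> (\<exists>u\<in>R. ?b = inv (nu u) \<otimes> ?a \<otimes> nu u)"
    using bij_betw_imp_surj_on[OF nu_bij, symmetric] by (simp add: conjugate_in_def)
  then show ?thesis
    using fix_iff by blast
qed

section \<open>Short fixed points by pumping\<close>

fun chain :: "nat list \<Rightarrow> (bool \<times> 'a) list \<Rightarrow> ((nat list \<Rightarrow> nat list \<Rightarrow> bool) \<times> nat list \<times> nat list) list" where
  "chain u [] = []"
| "chain u (l # ls) = (rel l, u, step u l) # chain (step u l) ls"

lemma length_chain: "length (chain u ls) = length ls"
  by (induction ls arbitrary: u) auto

lemma chain_rel:
  "u \<in> R \<Longrightarrow> snd ` set ls \<subseteq> X \<Longrightarrow> \<forall>(E, a, b)\<in>set (chain u ls). E a b \<and> E \<in> rel ` (UNIV \<times> X)"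
proof (induction ls arbitrary: u)
  case (Cons l ls)
  then have "rel l u (step u l)" "step u l \<in> R"
    by (simp_all add: rel_iff_step step_closed)
  moreover have "rel l \<in> rel ` (UNIV \<times> X)"
    using Cons.prems by (cases l) auto
  ultimately show ?case
    using Cons by simp
qed simp

text \<open>Constraints are functional, so \<open>\<phi>\<close> commutes with every step along the
  chain. As it is a single map on words, it sends a fixed point to a fixed point.\<close>

lemma chain_transport:
  assumes "snd ` set ls \<subseteq> X" "\<forall>(E, a, b)\<in>set (chain u ls). E (\<phi> a) (\<phi> b)"
  shows "\<phi> (foldl step u ls) = foldl step (\<phi> u) ls"
  using assms
proof (induction ls arbitrary: u)
  case (Cons l ls)
  then have "rel l (\<phi> u) (\<phi> (step u l))"
    by simp
  moreover from this have "\<phi> u \<in> R"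
    by (simp add: rel_def)
  ultimately have "\<phi> (step u l) = step (\<phi> u) l"
    using Cons.prems by (simp add: rel_iff_step)
  with Cons show ?case by simp
qed simp

lemma short_fixpoint:
  "\<exists>N>0. \<forall>ls. snd ` set ls \<subseteq> X \<longrightarrow> (\<exists>u\<in>R. foldl step u ls = u) \<longrightarrow>
     (\<exists>u\<in>R. foldl step u ls = u \<and> length u \<le> N ^ Suc (length ls))"
proof -
  \<comment> \<open>Placed in front of the chain, this constraint keeps \<open>\<phi> u\<close> in
    \<open>R\<close> and bounds its length even for empty \<open>ls\<close>; it accounts for the
    \<open>Suc\<close> in the exponent.\<close>
  let ?D = "\<lambda>u v. u \<in> R \<and> v \<in> lists \<Sigma>"
  let ?Es = "insert ?D (rel ` (UNIV \<times> X))"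
  have "automatic_rel ?D"
    by (rule automatic_rel_regular_language[OF finite_alphabet R_regular])
  then have "automatic_rel E" if "E \<in> ?Es" for E
    using that automatic_rel_rel by auto
  moreover have "finite ?Es"
    using finite_X by simp
  ultimately obtain N where N: "\<forall>E\<in>?Es. \<exists>d q F. recognizes N d q F E"
    using finite_automatic_rel_recognizes by meson
  then obtain d q F where "recognizes N d q F ?D"
    by blast
  \<comment> \<open>Some state lies below \<open>N\<close>, so \<open>N\<close> is positive;
    monotonicity of its powers in the exponent relies on this later.\<close>
  then have "run d q [] [] 0 < N"
    by (simp only: recognizes_def)
  then have "N > 0"
    by simp
  moreover have "\<exists>u\<in>R. foldl step u ls = u \<and> length u \<le> N ^ Suc (length ls)"
    if ls: "snd ` set ls \<subseteq> X" and u: "u \<in> R" "foldl step u ls = u" for ls u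
  proof -
    let ?cs = "(?D, u, u) # chain u ls"
    have "\<forall>(E, a, b)\<in>set ?cs. E a b \<and> E \<in> ?Es"
      using chain_rel[OF u(1) ls] u(1) R_words by fastforce
    then have "\<forall>(E, a, b)\<in>set ?cs. E a b \<and> (\<exists>d q F. recognizes N d q F E)"
    proof (intro ballI, clarify, intro conjI)
      fix E a b
      assume *: "\<forall>(E, a, b)\<in>set ?cs. E a b \<and> E \<in> ?Es" and c: "(E, a, b) \<in> set ?cs"
      have "E a b \<and> E \<in> ?Es"
        using bspec[OF * c] by simp
      then show "E a b" "\<exists>d q F. recognizes N d q F E"
        using bspec[OF N, of E] by simp_all
    qed
    then obtain \<phi> where \<phi>: "\<forall>(E, a, b)\<in>set ?cs. E (\<phi> a) (\<phi> b) \<and> length (\<phi> a) \<le> N ^ length ?cs"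
      using pump_constraints by blast
    then have "\<phi> (foldl step u ls) = foldl step (\<phi> u) ls"
      using ls by (intro chain_transport) auto
    then show ?thesis
      using \<phi> u by (intro bexI[of _ "\<phi> u"]) (auto simp: length_chain)
  qed
  ultimately show ?thesis by blast
qed

section \<open>The search for a conjugator on codes\<close>

text \<open>
  The disjunct \<open>list_decode n \<notin> R\<close> makes the search total.
\<close>

definition code_step :: "('a \<Rightarrow> nat) \<Rightarrow> bool \<Rightarrow> nat \<Rightarrow> nat \<Rightarrow> nat" where
  "code_step c b n a = (if a \<in> c ` X
     then LEAST m. rel (b, inv_into X c a) (list_decode n) (list_decode m) \<or> list_decode n \<notin> R else 0)"

lemma decidable_R:
  assumes "computable n f"
  shows "decidable n (\<lambda>xs. list_decode (f xs) \<in> R)"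
  \<comment> \<open>The code \<open>0\<close> puts the empty word on the second tape.\<close>
  using computable_apply2[OF decidable_automatic_rel[OF automatic_rel_regular_language[OF
        finite_alphabet R_regular]] assms computable_const[of _ 0]]
  by simp

lemma computable_code_step:
  assumes "inj_on c X"
  shows "computable 2 (\<lambda>xs. code_step c b (xs ! 0) (xs ! 1))"
  unfolding code_step_def
proof (rule computable_finite_cases)
  fix a
  assume a: "a \<in> c ` X"
  let ?l = "(b, inv_into X c a)"
  have l: "snd ?l \<in> X"
    using a by (simp add: inv_into_into)
  show "computable 2 (\<lambda>xs. LEAST m. rel ?l (list_decode (xs ! 0)) (list_decode m) \<or> list_decode (xs ! 0) \<notin> R)"
  proof (rule computable_Least)
    show "decidable (Suc 2) (\<lambda>ys. \<not> (rel ?l (list_decode (tl ys ! 0)) (list_decode (ys ! 0)) \<or>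
        list_decode (tl ys ! 0) \<notin> R))"
      by (intro decidable_not decidable_disj decidable_R
          computable_apply2[OF decidable_automatic_rel[OF automatic_rel_rel[OF l]]] computable_intros) auto
    show "\<exists>m. rel ?l (list_decode (xs ! 0)) (list_decode m) \<or> list_decode (xs ! 0) \<notin> R" for xs
      using rel_iff_step[OF _ l] list_encode_inverse by metis
  qed
qed (use finite_X in \<open>auto intro: computable_nth\<close>)

lemma code_step:
  assumes c: "inj_on c X" and "u \<in> R" "x \<in> X"
  shows "code_step c b (list_encode u) (c x) = list_encode (step u (b, x))"
proof -
  \<comment> \<open>For \<open>u \<in> R\<close> the search has exactly one solution, since
    \<open>rel\<close> is the graph of \<open>step\<close>.\<close>
  have *: "rel (b, x) u (list_decode m) \<or> u \<notin> R \<longleftrightarrow> m = list_encode (step u (b, x))" for m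
    using assms(2,3) rel_iff_step[of u "(b, x)"] list_decode_inverse list_encode_inverse
    by (metis snd_conv)
  have "(LEAST m. rel (b, x) u (list_decode m) \<or> u \<notin> R) = list_encode (step u (b, x))"
    unfolding * by (rule Least_equality) auto
  then show ?thesis
    using assms by (simp add: code_step_def)
qed

lemma foldl_code_step:
  assumes c: "inj_on c X" and "u \<in> R" "w \<in> lists X"
  shows "foldl (code_step c b) (list_encode u) (map c w) = list_encode (foldl step u (map (Pair b) w))"
  using assms(2,3) by (induction w arbitrary: u) (simp_all add: code_step[OF c] step_closed)

theorem conjugacy_decidable: "decidable_conjugacy_problem G X"
  unfolding decidable_conjugacy_problem_def decidable_on_words_def
proof (intro allI impI)
  fix c :: "'a \<Rightarrow> nat"
  assume c: "inj_on c X"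
  obtain N where N: "N > 0" "\<And>ls. snd ` set ls \<subseteq> X \<Longrightarrow> \<exists>u\<in>R. foldl step u ls = u \<Longrightarrow>
     \<exists>u\<in>R. foldl step u ls = u \<and> length u \<le> N ^ Suc (length ls)"
    using short_fixpoint by blast
  obtain C where C: "\<Sigma> \<subseteq> {..C}"
    using finite_alphabet finite_nat_set_iff_bounded_le[of \<Sigma>] by auto
  \<comment> \<open>The codes \<open>i\<close> and \<open>j\<close> bound the lengths of the two
    words, so \<open>code_bound\<close> at this power dominates the code of some fixed point if
    there is any. The outer \<open>Suc\<close> makes the bound strict.\<close>
  define B where "B i j = Suc (code_bound C (N ^ Suc (i + j)))" for i j
  let ?P = "\<lambda>i j. \<exists>n<B i j. list_decode n \<in> R \<and>
    foldl (code_step c False) (foldl (code_step c True) n (list_decode j)) (list_decode i) = n"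
  have "decidable 2 (\<lambda>xs. ?P (xs ! 0) (xs ! 1))"
    unfolding B_def
    by (intro decidable_Bex_less decidable_conj decidable_R decidable_eq
        computable_apply2[OF computable_foldl[OF computable_code_step[OF c]]]
        computable_code_bound computable_intros) auto
  then obtain r where r: "\<And>xs. length xs = 2 \<Longrightarrow> recf_eval r xs = Some (of_bool (?P (xs ! 0) (xs ! 1)))"
    unfolding computable_def by blast
  have "?P (list_encode (map c p)) (list_encode (map c q)) \<longleftrightarrow>
      conjugate_in G (word_value G p) (word_value G q)"
    if p: "p \<in> lists X" and q: "q \<in> lists X" for p q
  proof -
    have fold: "foldl (code_step c False) (foldl (code_step c True) (list_encode u) (map c q)) (map c p)
        = list_encode (foldl step u (conjugation p q))" if "u \<in> R" for u
    proof -
      have "foldl step u (map (Pair True) q) \<in> R"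
        using foldl_step[OF that, of "map (Pair True) q"] q by (auto simp: image_image)
      then show ?thesis
        using c that p q by (simp add: foldl_code_step conjugation_def)
    qed
    have "?P (list_encode (map c p)) (list_encode (map c q)) \<longleftrightarrow>
      (\<exists>u\<in>R. list_encode u < B (list_encode (map c p)) (list_encode (map c q)) \<and>
        foldl step u (conjugation p q) = u)" (is "_ \<longleftrightarrow> (\<exists>u\<in>R. ?small u \<and> ?fix u)")
      using fold by (metis list_decode_inverse list_encode_inverse)
    also have "\<dots> \<longleftrightarrow> (\<exists>u\<in>R. ?fix u)"
    proof
      assume "\<exists>u\<in>R. ?fix u"
      then obtain u where u: "u \<in> R" "?fix u" "length u \<le> N ^ Suc (length (conjugation p q))"
        using N(2)[OF conjugation_letters[OF p q]] by blast
      have "length (conjugation p q) \<le> list_encode (map c p) + list_encode (map c q)"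
        using length_le_code[of "map c p"] length_le_code[of "map c q"] by (simp add: conjugation_def)
      then have "N ^ Suc (length (conjugation p q)) \<le> N ^ Suc (list_encode (map c p) + list_encode (map c q))"
        using N(1) by (intro power_increasing) auto
      moreover have "set u \<subseteq> {..C}"
        using u(1) R_words C by auto
      ultimately have "?small u"
        using u(3) unfolding B_def less_Suc_eq_le by (blast intro: list_encode_le_code_bound order_trans)
      with u show "\<exists>u\<in>R. ?small u \<and> ?fix u" by blast
    qed blast
    finally show ?thesis
      using conjugate_iff_fixpoint[OF p q] by simp
  qed
  then show "\<exists>f. \<forall>p\<in>lists X. \<forall>q\<in>lists X.
      recf_eval f [list_encode (map c p), list_encode (map c q)] =
      Some (if conjugate_in G (word_value G p) (word_value G q) then 1 else 0)"
    using r by (intro exI[of _ r]) simp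
qed

end

theorem theorem8p5:
  fixes G :: "('a, 'm) monoid_scheme" and X :: "'a set"
  assumes "group G"
    and "finite X" and "X \<subseteq> carrier G"
    and "word_value G ` lists X = carrier G"
    and "graph_biautomatic G X"
  shows "decidable_conjugacy_problem G X"
proof -
  obtain \<Sigma> :: "nat set" and R nu where "graph_biautomatic_structure G X \<Sigma> R nu"
    using assms(5) unfolding graph_biautomatic_def by blast
  then interpret biautomatic_group G X \<Sigma> R nu
    using assms by (simp add: biautomatic_group_def biautomatic_group_axioms_def)
  show ?thesis
    by (rule conjugacy_decidable)
qed

end
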